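(* Let $n\ge 1$ and let $b_1,\dots,b_n\in\mathbb{R}$. Let $\mathbf{S}_n$ be the $n\times n$ discrete Schrödinger matrix with diagonal entries $b_1,\dots,b_n$, and let $\mathbf{F}_n$ be the $n\times n$ free discrete Schrödinger matrix. Suppose $\mathbf{S}_n$ shares all of its eigenvalues with $\mathbf{F}_n$, i.e. $\mathbf{S}_n$ and $\mathbf{F}_n$ have the same spectrum. Then $\mathbf{S}_n=\mathbf{F}_n$, i.e. $b_1=\cdots=b_n=0$.
   Context: The $n\times n$ discrete Schrödinger matrix $\mathbf{S}_n$ with real diagonal entries $b_1,\dots,b_n$ is the real symmetric tridiagonal matrix with $(\mathbf{S}_n)_{k,k}=b_k$ for $1\le k\le n$, $(\mathbf{S}_n)_{k,k+1}=(\mathbf{S}_n)_{k+1,k}=1$ for $1\le k\le n-1$, and all other entries $0$. The free discrete Schrödinger matrix $\mathbf{F}_n$ is the matrix $\mathbf{S}_n$ with $b_1=\cdots=b_n=0$. All eigenvalues of such matrices are real and simple. *)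

theory Defs
  imports "Jordan_Normal_Form.Spectral_Radius"
begin

(* Matrices of the AFP entry are indexed from 0, whereas the diagonal entries b 1, ..., b n are
   indexed from 1: position (i, j) of the matrix is the entry in row i + 1 and column j + 1. *)
definition schroedinger_mat :: "nat \<Rightarrow> (nat \<Rightarrow> real) \<Rightarrow> real mat" where
  "schroedinger_mat n b = mat n n (\<lambda>(i, j).
     if i = j then b (i + 1) else if j = i + 1 \<or> i = j + 1 then 1 else 0)"

definition free_schroedinger_mat :: "nat \<Rightarrow> real mat" where
  "free_schroedinger_mat n = schroedinger_mat n (\<lambda>_. 0)"

end

theory Submission
  imports Defs
begin

text \<open>The free matrix has the \<open>n\<close> distinct eigenvalues \<open>2 cos (j \<pi> / (n + 1))\<close>, so a matrix of
  size \<open>n\<close> with the same spectrum has the same split characteristic polynomial. By triangularisation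
  the two squares then have the same trace, and the traces differ by \<open>\<Sum> b\<^sub>k\<^sup>2\<close>.\<close>

definition mat_trace :: "'a :: comm_monoid_add mat \<Rightarrow> 'a" where
  "mat_trace A = (\<Sum>i<dim_row A. A $$ (i, i))"

lemma mat_trace_mult:
  fixes A B :: "'a :: comm_semiring_0 mat"
  assumes "A \<in> carrier_mat n m" "B \<in> carrier_mat m n"
  shows "mat_trace (A * B) = (\<Sum>i<n. \<Sum>j<m. A $$ (i, j) * B $$ (j, i))"
  unfolding mat_trace_def using assms
  by (intro sum.cong) (auto simp: scalar_prod_def atLeast0LessThan)

lemma mat_trace_mult_commute:
  fixes A B :: "'a :: comm_semiring_0 mat"
  assumes "A \<in> carrier_mat n m" "B \<in> carrier_mat m n"
  shows "mat_trace (A * B) = mat_trace (B * A)"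
  unfolding mat_trace_mult[OF assms] mat_trace_mult[OF assms(2,1)]
  by (subst sum.swap) (simp add: mult.commute)

text \<open>Cyclicity of the trace moves \<open>Q\<close> in front of \<open>P * B\<close>, where
  \<open>Q * P\<close> cancels to the identity.\<close>

lemma mat_trace_similar:
  fixes A B :: "'a :: comm_semiring_1 mat"
  assumes "similar_mat_wit A B P Q"
  shows "mat_trace A = mat_trace B"
proof -
  define n where "n = dim_row A"
  note wit = similar_mat_witD[OF n_def assms]
  have "mat_trace A = mat_trace (P * B * Q)"
    using wit(3) by simp
  also have "\<dots> = mat_trace (Q * (P * B))"
    by (rule mat_trace_mult_commute[of _ n n]) (use wit(5-7) in auto)
  also have "Q * (P * B) = B"
    using wit(2) wit(5-7) assoc_mult_mat[of Q n n P n B n] by simp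
  finally show ?thesis .
qed

text \<open>For \<open>i \<noteq> j\<close> one of the positions \<open>(i, j)\<close> and
  \<open>(j, i)\<close> lies below the diagonal, so the product of the two entries vanishes and only
  squares of diagonal entries survive.\<close>

lemma mat_trace_square_upper_triangular:
  fixes B :: "'a :: comm_semiring_1 mat"
  assumes "B \<in> carrier_mat n n" "upper_triangular B"
  shows "mat_trace (B * B) = (\<Sum>x\<leftarrow>diag_mat B. x\<^sup>2)"
proof -
  have "(\<Sum>j<n. B $$ (i, j) * B $$ (j, i)) = (B $$ (i, i))\<^sup>2" if "i < n" for i
  proof -
    have "B $$ (i, j) * B $$ (j, i) = (if j = i then (B $$ (i, i))\<^sup>2 else 0)" if "j < n" for j
      using assms \<open>i < n\<close> that upper_triangularD[of B i j] upper_triangularD[of B j i]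
      by (cases i j rule: linorder_cases) (auto simp: power2_eq_square)
    then show ?thesis using that by simp
  qed
  then show ?thesis
    using assms(1)
    by (simp add: mat_trace_mult[OF assms(1,1)] diag_mat_def sum_list_sum_nth atLeast0LessThan)
qed

text \<open>Schur decomposition makes \<open>A\<close> similar to an upper triangular matrix with
  diagonal \<open>es\<close>, and the same \<open>P\<close>, \<open>Q\<close> witness the similarity
  of the squares.\<close>

lemma mat_trace_square_split:
  fixes A :: "'a :: conjugatable_ordered_field mat"
  assumes "A \<in> carrier_mat n n" "char_poly A = (\<Prod>a\<leftarrow>es. [:- a, 1:])"
  shows "mat_trace (A * A) = (\<Sum>x\<leftarrow>es. x\<^sup>2)"
proof -
  obtain B P Q where schur: "schur_decomposition A es = (B, P, Q)"
    by (cases "schur_decomposition A es") auto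
  have wit: "similar_mat_wit A B P Q" and B: "upper_triangular B" "diag_mat B = es"
    using schur_decomposition[OF assms schur] by auto
  have carr: "B \<in> carrier_mat n n"
    using similar_mat_witD2[OF assms(1) wit] by simp
  have "A ^\<^sub>m 2 = A * A" "B ^\<^sub>m 2 = B * B"
    using assms(1) carr by (auto simp: numeral_2_eq_2)
  then have "mat_trace (A * A) = mat_trace (B * B)"
    using mat_trace_similar[OF similar_mat_wit_pow[OF wit, of 2]] by simp
  also have "\<dots> = (\<Sum>x\<leftarrow>es. x\<^sup>2)"
    using mat_trace_square_upper_triangular[OF carr B(1)] B(2) by simp
  finally show ?thesis .
qed

text \<open>Both sides are monic of degree \<open>n\<close> and vanish at the \<open>n\<close>
  distinct eigenvalues, so their difference has degree below \<open>n\<close> and at least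
  \<open>n\<close> roots.\<close>

lemma char_poly_simple_spectrum:
  fixes A :: "'a :: {linorder, field} mat"
  assumes A: "A \<in> carrier_mat n n" and card: "card (spectrum A) = n"
  shows "char_poly A = (\<Prod>a\<leftarrow>sorted_list_of_set (spectrum A). [:- a, 1:])"
proof (rule poly_eqI_degree_lead_coeff[where A = "spectrum A" and n = n])
  let ?es = "sorted_list_of_set (spectrum A)"
  let ?p = "\<Prod>a\<leftarrow>?es. [:- a, 1:]"
  have fin: "finite (spectrum A)" using card_finite_spectrum[OF A] by simp
  have deg: "degree ?p = n"
    using degree_linear_factors[of uminus ?es] card by simp
  have "lead_coeff ?p = 1"
    by (rule monic_prod_list) auto
  then show "coeff (char_poly A) n = coeff ?p n"
    using degree_monic_char_poly[OF A] deg by simp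
  show "degree (char_poly A) \<le> n" "degree ?p \<le> n"
    using degree_monic_char_poly[OF A] deg by auto
  show "poly (char_poly A) z = poly ?p z" if "z \<in> spectrum A" for z
    using that fin linear_poly_root[of z ?es] spectrum_root_char_poly[OF A] by auto
qed (use card in simp)

lemma schroedinger_mat_carrier [simp]: "schroedinger_mat n b \<in> carrier_mat n n"
  by (simp add: schroedinger_mat_def)

lemma free_schroedinger_mat_carrier [simp]: "free_schroedinger_mat n \<in> carrier_mat n n"
  by (simp add: free_schroedinger_mat_def)

lemma free_schroedinger_mat_mult_vec:
  assumes "i < n"
  shows "(free_schroedinger_mat n *\<^sub>v vec n f) $ i =
    (if 0 < i then f (i - 1) else 0) + (if i + 1 < n then f (i + 1) else 0)"
proof -
  have "(free_schroedinger_mat n *\<^sub>v vec n f) $ i =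
      (\<Sum>j<n. free_schroedinger_mat n $$ (i, j) * f j)"
    using assms
    by (simp add: free_schroedinger_mat_def schroedinger_mat_def scalar_prod_def atLeast0LessThan)
  \<comment> \<open>At \<open>i = 0\<close> truncated subtraction turns \<open>i - 1\<close> into
    \<open>0\<close>, a valid column; the inner test \<open>0 < i\<close> removes that spurious
    term.\<close>
  also have "\<dots> =
      (\<Sum>j<n. (if j = i - 1 then if 0 < i then f j else 0 else 0) +
        (if j = i + 1 then f j else 0))"
    using assms
    by (intro sum.cong) (auto simp: free_schroedinger_mat_def schroedinger_mat_def)
  also have "\<dots> = (if 0 < i then f (i - 1) else 0) + (if i + 1 < n then f (i + 1) else 0)"
    using assms by (simp add: sum.distrib)
  finally show ?thesis .
qed

text \<open>The entries \<open>sin ((k + 1) * t)\<close> form an eigenvector: sin (x - t) + sin (x +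
  t) = 2 cos t sin x gives the eigenvalue equation in every row, provided that the sine vanishes at
  the two positions just outside the vector.\<close>

lemma free_schroedinger_mat_eigenvalue:
  assumes "j \<in> {1..n}"
  shows "eigenvalue (free_schroedinger_mat n) (2 * cos (real j * pi / (real n + 1)))"
proof -
  define t where "t = real j * pi / (real n + 1)"
  define v where "v = vec n (\<lambda>k. sin ((real k + 1) * t))"
  have "0 < t" "t < pi"
    using assms by (auto simp: t_def pos_divide_less_eq mult.commute)
  \<comment> \<open>The choice of \<open>t\<close> makes \<open>(n + 1) * t\<close> a multiple of
    \<pi>, which is the boundary condition at the lower end.\<close>
  have last: "sin ((real n + 1) * t) = 0"
    by (simp add: t_def)
  have "v $ 0 = sin t"
    using assms by (simp add: v_def)
  moreover have "sin t > 0"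
    using \<open>0 < t\<close> \<open>t < pi\<close> by (rule sin_gt_zero)
  ultimately have "v \<noteq> 0\<^sub>v n"
    using assms by auto
  moreover have "free_schroedinger_mat n *\<^sub>v v = (2 * cos t) \<cdot>\<^sub>v v"
  proof (rule eq_vecI)
    fix i assume "i < dim_vec ((2 * cos t) \<cdot>\<^sub>v v)"
    then have i: "i < n" by (simp add: v_def)
    \<comment> \<open>In the first row the missing neighbour is replaced by sin 0 = 0, so one
      formula covers all rows.\<close>
    have prev: "(if 0 < i then sin ((real (i - 1) + 1) * t) else 0) = sin (real i * t)"
      by (auto simp: of_nat_diff)
    \<comment> \<open>In the last row, \<open>i + 1 = n\<close>, the missing neighbour is the zero
      supplied by \<open>last\<close>.\<close>
    have "(if i + 1 < n then sin ((real (i + 1) + 1) * t) else 0) = sin ((real i + 2) * t)"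
    proof (cases "i + 1 < n")
      case False
      then have "real n + 1 = real i + 2" using i by linarith
      then show ?thesis using last False by (simp add: add.commute)
    qed (simp add: algebra_simps)
    then have "(free_schroedinger_mat n *\<^sub>v v) $ i = sin (real i * t) + sin ((real i + 2) * t)"
      unfolding v_def free_schroedinger_mat_mult_vec[OF i] prev by simp
    also have "\<dots> = sin ((real i + 1) * t - t) + sin ((real i + 1) * t + t)"
      by (simp add: algebra_simps)
    also have "\<dots> = 2 * cos t * sin ((real i + 1) * t)"
      by (simp add: sin_add sin_diff)
    finally show "(free_schroedinger_mat n *\<^sub>v v) $ i = ((2 * cos t) \<cdot>\<^sub>v v) $ i"
      using i by (simp add: v_def)
  qed (simp add: v_def free_schroedinger_mat_def schroedinger_mat_def)
  ultimately show ?thesis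
    unfolding eigenvalue_def eigenvector_def t_def[symmetric]
    by (intro exI[of _ v]) (simp add: v_def free_schroedinger_mat_def schroedinger_mat_def)
qed

text \<open>Cosine is injective on [0, \<pi>], so the angles \<open>j * pi / (n + 1)\<close> give
  \<open>n\<close> different eigenvalues; the dimension allows no more.\<close>

lemma card_spectrum_free_schroedinger_mat: "card (spectrum (free_schroedinger_mat n)) = n"
proof (rule antisym)
  let ?f = "\<lambda>j. 2 * cos (real j * pi / (real n + 1))"
  have "inj_on ?f {1..n}"
  proof (rule inj_onI)
    fix i j assume ij: "i \<in> {1..n}" "j \<in> {1..n}" "?f i = ?f j"
    have le_pi: "real k * pi / (real n + 1) \<le> pi" if "k \<in> {1..n}" for k
      using that by (simp add: pos_divide_le_eq mult.commute)
    have "real i * pi / (real n + 1) = real j * pi / (real n + 1)"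
    proof (rule cos_inj_pi)
      show "cos (real i * pi / (real n + 1)) = cos (real j * pi / (real n + 1))"
        using ij(3) by simp
    qed (use le_pi ij(1,2) in simp_all)
    moreover have "real n + 1 \<noteq> 0" by linarith
    ultimately show "i = j"
      by (simp only: divide_cancel_right mult_cancel_right of_nat_eq_iff pi_neq_zero simp_thms)
  qed
  then have "n = card (?f ` {1..n})" by (simp add: card_image)
  also have "\<dots> \<le> card (spectrum (free_schroedinger_mat n))"
    using card_finite_spectrum(1)[OF free_schroedinger_mat_carrier] free_schroedinger_mat_eigenvalue
    by (intro card_mono) (auto simp: spectrum_def)
  finally show "n \<le> card (spectrum (free_schroedinger_mat n))" .
qed (rule card_finite_spectrum(2)[OF free_schroedinger_mat_carrier])

text \<open>The two matrices agree off the diagonal, and the free one is zero on it, so row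
  \<open>i\<close> of the double sum gains exactly the square of its diagonal entry.\<close>

lemma mat_trace_square_schroedinger:
  "mat_trace (schroedinger_mat n b * schroedinger_mat n b) =
   mat_trace (free_schroedinger_mat n * free_schroedinger_mat n) + (\<Sum>k<n. (b (k + 1))\<^sup>2)"
proof -
  let ?S = "schroedinger_mat n b" and ?F = "free_schroedinger_mat n"
  have "(\<Sum>j<n. ?S $$ (i, j) * ?S $$ (j, i)) =
      (\<Sum>j<n. ?F $$ (i, j) * ?F $$ (j, i)) + (b (i + 1))\<^sup>2" if "i < n" for i
  proof -
    have "(\<Sum>j<n. ?S $$ (i, j) * ?S $$ (j, i)) =
        (\<Sum>j<n. ?F $$ (i, j) * ?F $$ (j, i) + (if j = i then (b (i + 1))\<^sup>2 else 0))"
      using that by (intro sum.cong)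
        (auto simp: free_schroedinger_mat_def schroedinger_mat_def power2_eq_square)
    then show ?thesis using that by (simp add: sum.distrib)
  qed
  then show ?thesis
    by (simp add: mat_trace_mult[of _ n n] sum.distrib)
qed

theorem theorem3p3:
  fixes n :: nat and b :: "nat \<Rightarrow> real"
  assumes "n \<ge> 1"
    and "spectrum (schroedinger_mat n b) = spectrum (free_schroedinger_mat n)"
  shows "schroedinger_mat n b = free_schroedinger_mat n \<and> (\<forall>k\<in>{1..n}. b k = 0)"
proof -
  let ?S = "schroedinger_mat n b" and ?F = "free_schroedinger_mat n"
  \<comment> \<open>The spectrum is a set and does not record multiplicities; having
    \<open>n\<close> elements forces every eigenvalue of \<open>?S\<close> to be simple, so both
    characteristic polynomials split over the same list.\<close>
  have "card (spectrum ?S) = n"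
    using assms(2) card_spectrum_free_schroedinger_mat by simp
  then have "mat_trace (?S * ?S) = mat_trace (?F * ?F)"
    using assms(2) card_spectrum_free_schroedinger_mat[of n]
      mat_trace_square_split[OF _ char_poly_simple_spectrum, of ?S n n]
      mat_trace_square_split[OF _ char_poly_simple_spectrum, of ?F n n]
    by simp
  then have "(\<Sum>k<n. (b (k + 1))\<^sup>2) = 0"
    using mat_trace_square_schroedinger[of n b] by simp
  then have zero: "b (k + 1) = 0" if "k < n" for k
    using that by (simp add: sum_nonneg_eq_0_iff)
  have "b k = 0" if "k \<in> {1..n}" for k
    using that zero[of "k - 1"] by (cases k) auto
  moreover have "?S = ?F"
    using zero by (auto simp: free_schroedinger_mat_def schroedinger_mat_def)
  ultimately show ?thesis by blast
qed

end
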